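(* On the set $D = \mathbb{Z}\times\mathbb{Z}\times\mathbb{Z}$ define addition and multiplication by $$(k_1,k_2,k_3) + (t_1,t_2,t_3) = (k_1+t_1,\; k_2+t_2,\; k_3+t_3),$$ $$(k_1,k_2,k_3)(t_1,t_2,t_3) = \bigl(k_1+t_1,\; k_1t_1 + k_2 + t_2,\; k_3+t_3+\tfrac12(2k_2+k_1-k_1^2)t_1\bigr).$$ Then $D$ with these operations is a one-generator left brace. If $A$ is an arbitrary one-generator left brace such that $A\in\mathcal{N}_S(4,3)$, then there exists an epimorphism of left braces $f: D\to A$.
   Context: A left brace is a set $A$ with two binary operations $+$ and $\cdot$ such that $(A,+)$ is an abelian group, $(A,\cdot)$ is a group, and $a(b+c) = ab + ac - a$ for all $a,b,c\in A$. For $a,b\in A$ put $a*b = ab - a - b$. A subbrace of $A$ is a subset that is a subgroup of both the additive and the multiplicative group of $A$. $A$ is a one-generator left brace if there is an element $a\in A$ such that the smallest subbrace of $A$ containing $a$ is $A$ itself. An epimorphism of left braces is a surjective map preserving both addition and multiplication. For $K,L\subseteq A$, $K*L$ denotes the subgroup of $(A,+)$ generated by all elements $x*y$ with $x\in K$, $y\in L$. Put $A^{(1)}=A$, $A^{(n+1)} = A^{(n)}*A$, and $A^1 = A$, $A^{k+1} = A*A^k$ for positive integers $n,k$; in particular $A^2=A^{(2)}=A*A$, $A^{(4)} = ((A*A)*A)*A$ and $A^3 = A*(A*A)$. $\mathcal{N}_S(n,k)$ denotes the class of left braces $A$ with $A^{(n)}=\{0\}=A^k$, where $n$ and $k$ are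 each the least positive integers with this property. *)

theory Defs
  imports "HOL-Algebra.AbelCoset" "HOL-Algebra.Generated_Groups"
begin

text \<open>
  A left brace is carried by a ring record: \<open>\<oplus>\<close> and \<open>\<otimes>\<close> are the two group operations.
  The record fields \<open>\<zero>\<close> and \<open>\<one>\<close> are only required to be the respective neutral elements; that
  they coincide is a consequence of the axioms.
\<close>

locale left_brace = abelian_group A + group A for A (structure) +
  assumes brace_distrib:
    "\<lbrakk>a \<in> carrier A; b \<in> carrier A; c \<in> carrier A\<rbrakk>
      \<Longrightarrow> a \<otimes> (b \<oplus> c) = a \<otimes> b \<oplus> a \<otimes> c \<ominus> a"

definition brace_star :: "('a, 'm) ring_scheme \<Rightarrow> 'a \<Rightarrow> 'a \<Rightarrow> 'a" where
  "brace_star A a b = a \<otimes>\<^bsub>A\<^esub> b \<ominus>\<^bsub>A\<^esub> a \<ominus>\<^bsub>A\<^esub> b"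

definition subbrace :: "'a set \<Rightarrow> ('a, 'm) ring_scheme \<Rightarrow> bool" where
  "subbrace H A \<longleftrightarrow> subgroup H (add_monoid A) \<and> subgroup H A"

definition generated_subbrace :: "('a, 'm) ring_scheme \<Rightarrow> 'a \<Rightarrow> 'a set" where
  "generated_subbrace A a = \<Inter>{H. subbrace H A \<and> a \<in> H}"

definition one_generator_left_brace :: "('a, 'm) ring_scheme \<Rightarrow> bool" where
  "one_generator_left_brace A \<longleftrightarrow>
     left_brace A \<and> (\<exists>a \<in> carrier A. generated_subbrace A a = carrier A)"

definition brace_epi :: "('a, 'm) ring_scheme \<Rightarrow> ('b, 'n) ring_scheme \<Rightarrow> ('a \<Rightarrow> 'b) set" where
  "brace_epi A B =
     {f. f \<in> hom (add_monoid A) (add_monoid B) \<and> f \<in> hom A B \<and> f ` carrier A = carrier B}"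

definition star_set :: "('a, 'm) ring_scheme \<Rightarrow> 'a set \<Rightarrow> 'a set \<Rightarrow> 'a set" where
  "star_set A K L = generate (add_monoid A) {brace_star A x y | x y. x \<in> K \<and> y \<in> L}"

text \<open>
  \<open>right_series A n\<close> is \<open>A\<^sup>(\<^sup>n\<^sup>)\<close> and \<open>left_series A k\<close> is \<open>A\<^sup>k\<close>. Both
  series start at index 1; the value at index 0 is a dummy.
\<close>

fun right_series :: "('a, 'm) ring_scheme \<Rightarrow> nat \<Rightarrow> 'a set" where
  "right_series A 0 = carrier A"
| "right_series A (Suc 0) = carrier A"
| "right_series A (Suc (Suc n)) = star_set A (right_series A (Suc n)) (carrier A)"

fun left_series :: "('a, 'm) ring_scheme \<Rightarrow> nat \<Rightarrow> 'a set" where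
  "left_series A 0 = carrier A"
| "left_series A (Suc 0) = carrier A"
| "left_series A (Suc (Suc k)) = star_set A (carrier A) (left_series A (Suc k))"

definition NS :: "nat \<Rightarrow> nat \<Rightarrow> ('a, 'm) ring_scheme set" where
  "NS n k = {A. left_brace A
     \<and> 1 \<le> n \<and> right_series A n = {\<zero>\<^bsub>A\<^esub>} \<and> (\<forall>m. 1 \<le> m \<and> m < n \<longrightarrow> right_series A m \<noteq> {\<zero>\<^bsub>A\<^esub>})
     \<and> 1 \<le> k \<and> left_series A k = {\<zero>\<^bsub>A\<^esub>} \<and> (\<forall>m. 1 \<le> m \<and> m < k \<longrightarrow> left_series A m \<noteq> {\<zero>\<^bsub>A\<^esub>})}"

text \<open>
  The integer division below is exact, since \<open>k1 - k1\<^sup>2\<close> is even.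
\<close>

definition D_brace :: "(int \<times> int \<times> int) ring" where
  "D_brace = \<lparr>carrier = UNIV,
     mult = (\<lambda>(k1, k2, k3) (t1, t2, t3).
       (k1 + t1, k1 * t1 + k2 + t2, k3 + t3 + ((2 * k2 + k1 - k1\<^sup>2) div 2) * t1)),
     one = (0, 0, 0),
     zero = (0, 0, 0),
     add = (\<lambda>(k1, k2, k3) (t1, t2, t3). (k1 + t1, k2 + t2, k3 + t3))\<rparr>"

end

theory Submission
  imports Defs
begin

text \<open>
  Write \<open>\<lambda>\<^sub>x y = x y - x\<close>; each \<open>\<lambda>\<^sub>x\<close> is additive and
  \<open>\<lambda>\<^sub>x\<^sub>y = \<lambda>\<^sub>x \<lambda>\<^sub>y\<close>. Let \<open>a\<close> generate \<open>A\<close>, and put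
  \<open>b = a * a\<close>, \<open>c = b * a\<close>. Since \<open>A\<^sup>3 = 0\<close>, every \<open>\<lambda>\<^sub>x\<close> fixes all products
  \<open>y * a\<close>, so \<open>x \<mapsto> x * a\<close> turns multiplication into addition; since
  \<open>A\<^sup>(\<^sup>4\<^sup>) = 0\<close>, also \<open>c * a = 0\<close>. Comparing \<open>a (k a) = (k + 1) a + k b\<close> with this
  homomorphism gives \<open>(k a) * a = k b - binom(k, 2) c\<close>, which is the multiplication rule of \<open>D\<close>.
  So \<open>(k\<^sub>1, k\<^sub>2, k\<^sub>3) \<mapsto> k\<^sub>1 a + k\<^sub>2 b + k\<^sub>3 c\<close> is a homomorphism, and its image
  is a subbrace containing \<open>a\<close>.
\<close>

context left_brace
begin

section \<open>The maps \<open>lambda x\<close> of a left brace\<close>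

definition lambda :: "'a \<Rightarrow> 'a \<Rightarrow> 'a" where
  "lambda x y = x \<otimes> y \<ominus> x"

lemma lambda_closed [simp]:
  "x \<in> carrier A \<Longrightarrow> y \<in> carrier A \<Longrightarrow> lambda x y \<in> carrier A"
  by (simp add: lambda_def)

lemma add_minus_self [simp]:
  "x \<in> carrier A \<Longrightarrow> y \<in> carrier A \<Longrightarrow> x \<oplus> (y \<ominus> x) = y"
  by (metis a_minus_def a_inv_closed a_comm a_closed r_neg1)

lemma mult_eq_add_lambda:
  "x \<in> carrier A \<Longrightarrow> y \<in> carrier A \<Longrightarrow> x \<otimes> y = x \<oplus> lambda x y"
  by (simp add: lambda_def)

lemma lambda_add:
  assumes "x \<in> carrier A" "y \<in> carrier A" "z \<in> carrier A"
  shows "lambda x (y \<oplus> z) = lambda x y \<oplus> lambda x z"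
  using assms by (simp add: lambda_def brace_distrib a_minus_def a_ac)

text \<open>Write \<open>x \<otimes> y \<otimes> z\<close> as a sum in two ways, with first factor
  \<open>x \<otimes> y\<close> and with first factor \<open>x\<close>, and cancel
  \<open>x \<otimes> y\<close>.\<close>

lemma lambda_mult:
  assumes "x \<in> carrier A" "y \<in> carrier A" "z \<in> carrier A"
  shows "lambda (x \<otimes> y) z = lambda x (lambda y z)"
proof -
  have "(x \<otimes> y) \<oplus> lambda (x \<otimes> y) z = x \<otimes> (y \<oplus> lambda y z)"
    using assms by (simp add: m_assoc flip: mult_eq_add_lambda)
  also have "\<dots> = x \<oplus> lambda x (y \<oplus> lambda y z)"
    using assms by (simp add: mult_eq_add_lambda)
  also have "\<dots> = (x \<otimes> y) \<oplus> lambda x (lambda y z)"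
    using assms by (simp add: lambda_add mult_eq_add_lambda a_assoc)
  finally show ?thesis
    using assms by simp
qed

lemma lambda_int_mult:
  fixes k :: int
  assumes "x \<in> carrier A" "y \<in> carrier A"
  shows "lambda x ([k] \<cdot> y) = [k] \<cdot> lambda x y"
proof -
  interpret h: group_hom "add_monoid A" "add_monoid A" "lambda x"
    using assms(1) by unfold_locales (auto simp: hom_def lambda_add)
  show ?thesis
    using h.hom_int_pow[of y k] assms(2) by (simp add: add_pow_def)
qed

lemma lambda_eq_add_star:
  assumes "x \<in> carrier A" "y \<in> carrier A"
  shows "lambda x y = y \<oplus> brace_star A x y"
  using assms by (simp add: lambda_def brace_star_def)

lemma brace_star_closed [simp]:
  "x \<in> carrier A \<Longrightarrow> y \<in> carrier A \<Longrightarrow> brace_star A x y \<in> carrier A"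
  by (simp add: brace_star_def)

text \<open>Additivity of \<open>lambda \<one>\<close> gives
  \<open>lambda \<one> \<zero> = \<zero>\<close>, so \<open>\<one> \<otimes> \<zero>\<close> is both
  \<open>\<zero>\<close> and \<open>\<one>\<close>.\<close>

lemma zero_eq_one: "\<zero> = \<one>"
proof -
  have "\<one> \<oplus> lambda \<one> \<zero> = \<zero>"
    by (metis mult_eq_add_lambda l_one one_closed zero_closed)
  moreover have "lambda \<one> \<zero> = \<zero>"
    using lambda_add[of \<one> \<zero> \<zero>]
    by (metis add.r_cancel_one' lambda_closed l_zero one_closed zero_closed)
  ultimately show ?thesis by simp
qed

lemma zero_int_mult [simp]: "[(0::int)] \<cdot> x = \<zero>"
  by (simp add: add_pow_def)

lemma int_mult_Suc:
  "x \<in> carrier A \<Longrightarrow> [(k + 1)] \<cdot> x = [k] \<cdot> x \<oplus> x" for k :: int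
  by (simp add: add.int_pow_mult)

text \<open>Two-way induction from 0 turns a recursion with constant increment into a closed form;
  the step down cancels \<open>d\<close>.\<close>

lemma eq_int_mult_if_increments:
  fixes g :: "int \<Rightarrow> 'a"
  assumes "d \<in> carrier A" "\<And>k. g k \<in> carrier A" "g 0 = \<zero>"
    and step: "\<And>k. g (k + 1) = g k \<oplus> d"
  shows "g k = [k] \<cdot> d"
proof (induction k rule: int_induct[where k = 0])
  case base
  show ?case using assms by simp
next
  case (step1 i)
  then show ?case using assms by (simp add: int_mult_Suc)
next
  case (step2 i)
  have "g (i - 1) \<oplus> d = [(i - 1)] \<cdot> d \<oplus> d"
    using step[of "i - 1"] int_mult_Suc[of d "i - 1"] step2 assms(1) by simp
  then show ?case using assms by simp
qed

text \<open>Since \<open>lambda x y = y \<oplus> x * y\<close>, these are the \<open>y\<close> with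
  \<open>x * y = \<zero>\<close> for all \<open>x\<close>.\<close>

definition lambda_fixed :: "'a set" where
  "lambda_fixed = {y \<in> carrier A. \<forall>x \<in> carrier A. lambda x y = y}"

lemma lambda_fixed_carrier: "y \<in> lambda_fixed \<Longrightarrow> y \<in> carrier A"
  by (simp add: lambda_fixed_def)

lemma mult_lambda_fixed:
  "x \<in> carrier A \<Longrightarrow> y \<in> lambda_fixed \<Longrightarrow> x \<otimes> y = x \<oplus> y"
  by (simp add: lambda_fixed_def mult_eq_add_lambda)

lemma lambda_fixed_int_mult:
  "y \<in> lambda_fixed \<Longrightarrow> [k] \<cdot> y \<in> lambda_fixed" for k :: int
  by (simp add: lambda_fixed_def lambda_int_mult)

text \<open>Expanding \<open>lambda (x \<otimes> y) a\<close> by \<open>lambda_mult\<close> leaves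
  the cross term \<open>lambda x (y * a)\<close>, which the last hypothesis reduces to
  \<open>y * a\<close>.\<close>

lemma star_mult:
  assumes "x \<in> carrier A" "y \<in> carrier A" "a \<in> carrier A" "brace_star A y a \<in> lambda_fixed"
  shows "brace_star A (x \<otimes> y) a = brace_star A x a \<oplus> brace_star A y a"
proof -
  have "a \<oplus> brace_star A (x \<otimes> y) a = lambda x (a \<oplus> brace_star A y a)"
    using assms by (simp add: lambda_mult flip: lambda_eq_add_star)
  also have "\<dots> = a \<oplus> (brace_star A x a \<oplus> brace_star A y a)"
    using assms by (simp add: lambda_add lambda_eq_add_star[of x a] lambda_fixed_def a_assoc)
  finally show ?thesis
    using assms by simp
qed

section \<open>The map from \<open>D_brace\<close>, under consequences of
  \<open>A\<^sup>3 = 0\<close> and \<open>A\<^sup>(\<^sup>4\<^sup>) = 0\<close>\<close>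

context
  fixes a b c :: 'a
  assumes a: "a \<in> carrier A"
    and star_fixed: "\<And>x. x \<in> carrier A \<Longrightarrow> brace_star A x a \<in> lambda_fixed"
    and b: "b = brace_star A a a" and c: "c = brace_star A b a"
    and c_star: "brace_star A c a = \<zero>"
begin

lemma b_fixed: "b \<in> lambda_fixed" and c_fixed: "c \<in> lambda_fixed"
  and bc_carrier: "b \<in> carrier A" "c \<in> carrier A"
proof -
  show b': "b \<in> lambda_fixed"
    unfolding b by (rule star_fixed[OF a])
  show b'': "b \<in> carrier A"
    by (rule lambda_fixed_carrier[OF b'])
  show c': "c \<in> lambda_fixed"
    unfolding c by (rule star_fixed[OF b''])
  show "c \<in> carrier A"
    by (rule lambda_fixed_carrier[OF c'])
qed

context
  notes bc_carrier [simp]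
begin

text \<open>Adding a fixed \<open>y\<close> is the same as multiplying by it on the right, so
  \<open>star_mult\<close> applies.\<close>

lemma star_add_fixed:
  assumes "x \<in> carrier A" "y \<in> lambda_fixed"
  shows "brace_star A (x \<oplus> y) a = brace_star A x a \<oplus> brace_star A y a"
  using assms a star_fixed star_mult[of x y a]
  by (simp add: mult_lambda_fixed lambda_fixed_carrier)

lemma zero_star: "brace_star A \<zero> a = \<zero>"
proof -
  have "\<zero> \<otimes> a = a"
    unfolding zero_eq_one using a by (rule l_one)
  then have "brace_star A \<zero> a = a \<ominus> \<zero> \<ominus> a"
    by (simp only: brace_star_def)
  then show ?thesis
    using a minus_equality[of \<zero> \<zero>] by (simp add: a_minus_def r_neg)
qed

lemma int_mult_star:
  fixes k :: int
  assumes "y \<in> lambda_fixed"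
  shows "brace_star A ([k] \<cdot> y) a = [k] \<cdot> brace_star A y a"
proof (rule eq_int_mult_if_increments[where g = "\<lambda>k. brace_star A ([k] \<cdot> y) a"])
  show "brace_star A ([(k + 1)] \<cdot> y) a = brace_star A ([k] \<cdot> y) a \<oplus> brace_star A y a" for k :: int
    using assms by (simp add: int_mult_Suc lambda_fixed_carrier star_add_fixed)
qed (use assms a lambda_fixed_carrier zero_star in auto)

lemma int_mult_generator_star:
  fixes k :: int
  shows "brace_star A ([k] \<cdot> a) a = [k] \<cdot> b \<oplus> [((k - k\<^sup>2) div 2)] \<cdot> c"
proof -
  \<comment> \<open>The coefficient is minus binom(k, 2). Subtracting this multiple of
    \<open>c\<close> absorbs the term \<open>[k] \<cdot> c\<close> of \<open>rec\<close>, so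
    \<open>?g\<close> grows by \<open>b\<close> at each step.\<close>
  let ?g = "\<lambda>k::int. brace_star A ([k] \<cdot> a) a \<ominus> [((k - k\<^sup>2) div 2)] \<cdot> c"
  have rec: "brace_star A ([(k + 1)] \<cdot> a) a \<oplus> [k] \<cdot> c = b \<oplus> brace_star A ([k] \<cdot> a) a" for k :: int
  proof -
    \<comment> \<open>\<open>lambda a\<close> sends \<open>[k] \<cdot> a\<close> to
      \<open>[k] \<cdot> (a \<oplus> b)\<close>; applying \<open>* a\<close> to both sides of the
      resulting equation then yields the recursion.\<close>
    have "a \<otimes> [k] \<cdot> a = [(k + 1)] \<cdot> a \<oplus> [k] \<cdot> b"
      using a lambda_eq_add_star[of a a]
      by (simp add: mult_eq_add_lambda lambda_int_mult int_mult_Suc add.int_pow_distrib a_ac flip: b)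
    then have "brace_star A ([(k + 1)] \<cdot> a \<oplus> [k] \<cdot> b) a = b \<oplus> brace_star A ([k] \<cdot> a) a"
      using a b star_fixed star_mult[of a "[k] \<cdot> a" a] by simp
    then show ?thesis
      using a b_fixed by (simp add: star_add_fixed lambda_fixed_int_mult int_mult_star flip: c)
  qed
  have "?g k = [k] \<cdot> b"
  proof (rule eq_int_mult_if_increments)
    show "?g (k + 1) = ?g k \<oplus> b" for k :: int
    proof -
      \<comment> \<open>\<open>k * 2\<close> is a multiple of the divisor, so \<open>k\<close> moves
        under \<open>div\<close> without a parity argument.\<close>
      have "(k + 1 - (k + 1)\<^sup>2) div 2 + k = ((k + 1 - (k + 1)\<^sup>2) + k * 2) div 2"
        by simp
      also have "\<dots> = (k - k\<^sup>2) div 2"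
        by (simp add: power2_eq_square algebra_simps)
      finally have q: "(k - k\<^sup>2) div 2 = (k + 1 - (k + 1)\<^sup>2) div 2 + k" by simp
      let ?r = "[((k + 1 - (k + 1)\<^sup>2) div 2)] \<cdot> c"
      have "?g k \<oplus> b = (b \<oplus> brace_star A ([k] \<cdot> a) a) \<ominus> (?r \<oplus> [k] \<cdot> c)"
        unfolding q using a by (simp add: add.int_pow_mult a_minus_def a_ac)
      also have "\<dots> = (brace_star A ([(k + 1)] \<cdot> a) a \<oplus> [k] \<cdot> c) \<ominus> (?r \<oplus> [k] \<cdot> c)"
        by (simp only: rec)
      also have "\<dots> = ?g (k + 1)"
        using a by (simp add: a_minus_def minus_add a_ac r_neg1 r_neg2)
      finally show ?thesis by simp
    qed
  qed (use a zero_star in \<open>auto simp: a_minus_def\<close>)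
  then show ?thesis
    using a add_minus_self[of "[((k - k\<^sup>2) div 2)] \<cdot> c" "brace_star A ([k] \<cdot> a) a"]
    by (simp add: a_comm)
qed

definition D_map :: "int \<times> int \<times> int \<Rightarrow> 'a" where
  "D_map = (\<lambda>(k1, k2, k3). [k1] \<cdot> a \<oplus> ([k2] \<cdot> b \<oplus> [k3] \<cdot> c))"

lemma D_map_carrier: "D_map k \<in> carrier A"
  using a by (simp add: D_map_def split: prod.split)

text \<open>The coefficient of \<open>c\<close> collects minus binom(k1, 2) from
  \<open>[k1] \<cdot> a\<close> and \<open>k2\<close> from \<open>[k2] \<cdot> b\<close>; the
  summand \<open>[k3] \<cdot> c\<close> contributes zero by \<open>c_star\<close>.\<close>

lemma D_map_star:
  "brace_star A (D_map (k1, k2, k3)) a = [k1] \<cdot> b \<oplus> [((2 * k2 + k1 - k1\<^sup>2) div 2)] \<cdot> c"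
proof -
  have q: "(2 * k2 + k1 - k1\<^sup>2) div 2 = (k1 - k1\<^sup>2) div 2 + k2"
    by (simp add: algebra_simps div_mult_self1[of 2 "k1 - k1\<^sup>2" k2, simplified])
  have "brace_star A (D_map (k1, k2, k3)) a
      = brace_star A ([k1] \<cdot> a) a \<oplus> brace_star A ([k2] \<cdot> b) a \<oplus> brace_star A ([k3] \<cdot> c) a"
    using a b_fixed c_fixed
    by (simp add: D_map_def star_add_fixed lambda_fixed_int_mult flip: a_assoc)
  then show ?thesis
    unfolding q using a b_fixed c_fixed
    by (simp add: int_mult_generator_star int_mult_star c_star add.int_pow_mult a_assoc flip: c)
qed

lemma D_map_add: "D_map (k \<oplus>\<^bsub>D_brace\<^esub> t) = D_map k \<oplus> D_map t"
  using a by (simp add: D_map_def D_brace_def add.int_pow_mult a_ac split: prod.split)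

text \<open>In \<open>x \<otimes> y = x \<oplus> lambda x y\<close> the map \<open>lambda x\<close>
  fixes the multiples of \<open>b\<close> and \<open>c\<close>, so only its value
  \<open>a \<oplus> x * a\<close> on \<open>a\<close> matters, and \<open>D_map_star\<close>
  computes it.\<close>

lemma D_map_mult: "D_map (k \<otimes>\<^bsub>D_brace\<^esub> t) = D_map k \<otimes> D_map t"
proof -
  obtain k1 k2 k3 t1 t2 t3 where kt: "k = (k1, k2, k3)" "t = (t1, t2, t3)"
    by (metis prod.exhaust)
  have fixed: "lambda (D_map k) ([i] \<cdot> b) = [i] \<cdot> b" "lambda (D_map k) ([i] \<cdot> c) = [i] \<cdot> c"
    for i :: int
    using b_fixed c_fixed D_map_carrier lambda_fixed_int_mult by (auto simp: lambda_fixed_def)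
  define q where "q = (2 * k2 + k1 - k1\<^sup>2) div 2"
  have Dt: "D_map t = [t1] \<cdot> a \<oplus> ([t2] \<cdot> b \<oplus> [t3] \<cdot> c)"
    by (simp add: D_map_def kt)
  have "lambda (D_map k) (D_map t) = [t1] \<cdot> lambda (D_map k) a \<oplus> ([t2] \<cdot> b \<oplus> [t3] \<cdot> c)"
    using a D_map_carrier[of k] by (simp add: Dt lambda_add lambda_int_mult fixed)
  also have "lambda (D_map k) a = a \<oplus> ([k1] \<cdot> b \<oplus> [q] \<cdot> c)"
    using a D_map_carrier[of k] by (simp add: lambda_eq_add_star kt D_map_star q_def)
  finally have "D_map k \<otimes> D_map t
      = D_map k \<oplus> ([t1] \<cdot> (a \<oplus> ([k1] \<cdot> b \<oplus> [q] \<cdot> c)) \<oplus> ([t2] \<cdot> b \<oplus> [t3] \<cdot> c))"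
    by (simp add: mult_eq_add_lambda D_map_carrier)
  also have "\<dots> = D_map (k1 + t1, k1 * t1 + k2 + t2, k3 + t3 + q * t1)"
    using a by (simp add: D_map_def kt add.int_pow_mult add.int_pow_distrib add.int_pow_pow a_ac mult.commute)
  finally show ?thesis
    by (simp add: kt D_brace_def q_def)
qed

end

end

end

section \<open>The left brace \<open>D_brace\<close>\<close>

lemma D_brace_simps [simp]:
  "carrier D_brace = UNIV" "\<zero>\<^bsub>D_brace\<^esub> = (0, 0, 0)" "\<one>\<^bsub>D_brace\<^esub> = (0, 0, 0)"
  "(k1, k2, k3) \<oplus>\<^bsub>D_brace\<^esub> (t1, t2, t3) = (k1 + t1, k2 + t2, k3 + t3)"
  "(k1, k2, k3) \<otimes>\<^bsub>D_brace\<^esub> (t1, t2, t3) =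
     (k1 + t1, k1 * t1 + k2 + t2, k3 + t3 + ((2 * k2 + k1 - k1\<^sup>2) div 2) * t1)"
  by (simp_all add: D_brace_def)

lemma abelian_group_D_brace: "abelian_group D_brace"
proof (rule abelian_groupI)
  fix x
  show "\<exists>y \<in> carrier D_brace. y \<oplus>\<^bsub>D_brace\<^esub> x = \<zero>\<^bsub>D_brace\<^esub>"
    by (rule bexI[of _ "(- fst x, - fst (snd x), - snd (snd x))"]) (cases x, simp_all)
qed (auto simp: algebra_simps)

text \<open>\<open>k \<mapsto> (2 k\<^sub>2 + k\<^sub>1 - k\<^sub>1\<^sup>2) / 2\<close> turns products into sums; this is associativity.\<close>

lemma D_brace_cocycle:
  fixes k1 k2 t1 t2 :: int
  shows "(2 * (k1 * t1 + k2 + t2) + (k1 + t1) - (k1 + t1)\<^sup>2) div 2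
    = (2 * k2 + k1 - k1\<^sup>2) div 2 + (2 * t2 + t1 - t1\<^sup>2) div 2"
proof -
  have "even (2 * k2 + k1 - k1\<^sup>2)" "even (2 * t2 + t1 - t1\<^sup>2)"
    by simp_all
  moreover have "2 * (k1 * t1 + k2 + t2) + (k1 + t1) - (k1 + t1)\<^sup>2
      = (2 * k2 + k1 - k1\<^sup>2) + (2 * t2 + t1 - t1\<^sup>2)"
    by (simp add: power2_eq_square algebra_simps)
  ultimately show ?thesis by (simp only: div_add)
qed

lemma group_D_brace: "group D_brace"
proof (rule groupI)
  fix x y z
  show "x \<otimes>\<^bsub>D_brace\<^esub> y \<otimes>\<^bsub>D_brace\<^esub> z = x \<otimes>\<^bsub>D_brace\<^esub> (y \<otimes>\<^bsub>D_brace\<^esub> z)"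
    \<comment> \<open>Once \<open>D_brace_cocycle\<close> has split the quotient, the
      \<open>div\<close> terms act as atoms and a polynomial identity remains.\<close>
    by (cases x; cases y; cases z; simp only: D_brace_simps prod.inject D_brace_cocycle)
      (simp add: algebra_simps)
  obtain k1 k2 k3 where x: "x = (k1, k2, k3)" by (cases x)
  \<comment> \<open>A left inverse, solved coordinate by coordinate: the quotient in the third entry
    depends only on \<open>y1\<close> and \<open>y2\<close>, so \<open>y3\<close> can be chosen
    last.\<close>
  define y1 y2 where "y1 = - k1" and "y2 = k1 * k1 - k2"
  define y3 where "y3 = - k3 - ((2 * y2 + y1 - y1\<^sup>2) div 2) * k1"
  have "(y1, y2, y3) \<otimes>\<^bsub>D_brace\<^esub> x = \<one>\<^bsub>D_brace\<^esub>"
    by (simp add: x y3_def) (simp add: y1_def y2_def)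
  then show "\<exists>y \<in> carrier D_brace. y \<otimes>\<^bsub>D_brace\<^esub> x = \<one>\<^bsub>D_brace\<^esub>"
    by auto
qed auto

lemma left_brace_D_brace: "left_brace D_brace"
proof -
  interpret D: abelian_group D_brace by (rule abelian_group_D_brace)
  show ?thesis
  proof (intro left_brace.intro left_brace_axioms.intro abelian_group_D_brace group_D_brace)
    fix x y z
    \<comment> \<open>With \<open>x\<close> moved to the left-hand side no additive inverse occurs,
      and the identity can be checked in coordinates.\<close>
    have "x \<otimes>\<^bsub>D_brace\<^esub> (y \<oplus>\<^bsub>D_brace\<^esub> z) \<oplus>\<^bsub>D_brace\<^esub> x
        = x \<otimes>\<^bsub>D_brace\<^esub> y \<oplus>\<^bsub>D_brace\<^esub> x \<otimes>\<^bsub>D_brace\<^esub> z"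
      by (cases x; cases y; cases z) (simp add: algebra_simps)
    then show "x \<otimes>\<^bsub>D_brace\<^esub> (y \<oplus>\<^bsub>D_brace\<^esub> z)
        = x \<otimes>\<^bsub>D_brace\<^esub> y \<oplus>\<^bsub>D_brace\<^esub> x \<otimes>\<^bsub>D_brace\<^esub> z \<ominus>\<^bsub>D_brace\<^esub> x"
      by (metis D.add.inv_solve_right' a_minus_def D_brace_simps(1) UNIV_I)
  qed
qed

section \<open>Generation of \<open>D_brace\<close> by one element\<close>

lemma (in left_brace) subbrace_star:
  assumes "subbrace H A" "x \<in> H" "y \<in> H"
  shows "brace_star A x y \<in> H"
proof -
  interpret add: subgroup H "add_monoid A" using assms by (simp add: subbrace_def)
  interpret mult: subgroup H A using assms by (simp add: subbrace_def)
  have "\<ominus> z \<in> H" if "z \<in> H" for z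
    using add.m_inv_closed[OF that] by (simp add: a_inv_def)
  then show ?thesis
    using add.m_closed mult.m_closed assms by (simp add: brace_star_def a_minus_def)
qed

lemma (in left_brace) subbrace_int_mult:
  fixes k :: int
  assumes "subbrace H A" "x \<in> H"
  shows "[k] \<cdot> x \<in> H"
  using add.subgroup_int_pow_closed[of H x k] assms by (simp add: subbrace_def)

lemma D_brace_int_mult: "[k] \<cdot>\<^bsub>D_brace\<^esub> (x, y, z) = (k * x, k * y, k * z)" for k :: int
proof -
  interpret D: left_brace D_brace by (rule left_brace_D_brace)
  show ?thesis
    by (rule D.eq_int_mult_if_increments[symmetric]) (auto simp: algebra_simps)
qed

lemma D_brace_star:
  "brace_star D_brace (k1, k2, k3) (t1, t2, t3) =
     (0, k1 * t1, ((2 * k2 + k1 - k1\<^sup>2) div 2) * t1)"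
proof -
  interpret D: left_brace D_brace by (rule left_brace_D_brace)
  \<comment> \<open>The unknown coordinates are read off from
    \<open>x \<otimes> y = x \<oplus> (y \<oplus> x * y)\<close>, again without additive
    inverses.\<close>
  obtain s1 s2 s3 where s: "brace_star D_brace (k1, k2, k3) (t1, t2, t3) = (s1, s2, s3)"
    by (cases "brace_star D_brace (k1, k2, k3) (t1, t2, t3)")
  show ?thesis
    using D.mult_eq_add_lambda[of "(k1, k2, k3)" "(t1, t2, t3)"]
      D.lambda_eq_add_star[of "(k1, k2, k3)" "(t1, t2, t3)"]
    by (simp add: s)
qed

lemma one_generator_D_brace: "one_generator_left_brace D_brace"
proof -
  interpret D: left_brace D_brace by (rule left_brace_D_brace)
  have "x \<in> H" if H: "subbrace H D_brace" "(1, 0, 0) \<in> H" for x H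
  proof -
    obtain k1 k2 k3 where x: "x = (k1, k2, k3)" by (cases x)
    \<comment> \<open>For \<open>a = (1, 0, 0)\<close> the other two unit vectors are
      \<open>a * a\<close> and \<open>(a * a) * a\<close>; together the three span everything
      additively.\<close>
    have b: "(0, 1, 0) \<in> H"
      using D.subbrace_star[OF H(1) H(2) H(2)] by (simp add: D_brace_star)
    have c: "(0, 0, 1) \<in> H"
      using D.subbrace_star[OF H(1) b H(2)] by (simp add: D_brace_star)
    have "subgroup H (add_monoid D_brace)"
      using H by (simp add: subbrace_def)
    note closed = subgroup.m_closed[OF this, simplified]
    have "(k1, 0, 0) \<oplus>\<^bsub>D_brace\<^esub> ((0, k2, 0) \<oplus>\<^bsub>D_brace\<^esub> (0, 0, k3)) \<in> H"
      using D.subbrace_int_mult[OF H, of k1] D.subbrace_int_mult[OF H(1) b, of k2]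
        D.subbrace_int_mult[OF H(1) c, of k3]
      by (intro closed) (simp_all add: D_brace_int_mult)
    then show ?thesis by (simp add: x)
  qed
  then have "generated_subbrace D_brace (1, 0, 0) = carrier D_brace"
    by (auto simp: generated_subbrace_def)
  then show ?thesis
    using left_brace_D_brace by (auto simp: one_generator_left_brace_def)
qed

section \<open>The epimorphism onto \<open>A\<close>\<close>

lemma (in left_brace) ex_brace_epi_D_brace:
  assumes a: "a \<in> carrier A" "generated_subbrace A a = carrier A"
    and left: "left_series A 3 = {\<zero>}" and right: "right_series A 4 = {\<zero>}"
  shows "\<exists>f. f \<in> brace_epi D_brace A"
proof -
  define b where "b = brace_star A a a"
  define c where "c = brace_star A b a"
  have star_set_incl: "brace_star A x y \<in> star_set A K L" if "x \<in> K" "y \<in> L" for x y K L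
    unfolding star_set_def by (rule generate.incl) (use that in auto)
  have star_fixed: "brace_star A x a \<in> lambda_fixed" if x: "x \<in> carrier A" for x
    unfolding lambda_fixed_def
  proof (intro CollectI conjI ballI)
    show "brace_star A x a \<in> carrier A"
      using x a(1) by simp
    fix y assume y: "y \<in> carrier A"
    \<comment> \<open>\<open>x * a\<close> lies in \<open>A\<^sup>2\<close>, hence
      \<open>y * (x * a)\<close> in \<open>A\<^sup>3\<close>.\<close>
    have "brace_star A y (brace_star A x a) \<in> left_series A 3"
      using y a(1) x by (auto simp: numeral_3_eq_3 intro!: star_set_incl)
    then have "brace_star A y (brace_star A x a) = \<zero>"
      by (simp only: left singleton_iff)
    then show "lambda y (brace_star A x a) = brace_star A x a"
      using lambda_eq_add_star[OF y, of "brace_star A x a"] x a(1) by simp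
  qed
  \<comment> \<open>\<open>b\<close> lies in \<open>A\<^sup>(\<^sup>2\<^sup>)\<close> and
    \<open>c\<close> in \<open>A\<^sup>(\<^sup>3\<^sup>)\<close>.\<close>
  have "brace_star A c a \<in> right_series A 4"
    using a(1) unfolding b_def c_def by (auto simp: numeral_eq_Suc intro!: star_set_incl)
  then have c_star: "brace_star A c a = \<zero>" by (simp only: right singleton_iff)
  define f where "f = D_map a b c"
  note ctxt = a(1) star_fixed b_def c_def c_star
  have carrier: "f k \<in> carrier A" for k
    unfolding f_def by (rule D_map_carrier[OF ctxt])
  have add: "f \<in> hom (add_monoid D_brace) (add_monoid A)"
    by (simp add: hom_def f_def D_map_add[OF ctxt] D_map_carrier[OF ctxt] del: split_paired_All)
  have mult: "f \<in> hom D_brace A"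
    by (simp add: hom_def f_def D_map_mult[OF ctxt] D_map_carrier[OF ctxt] del: split_paired_All)
  interpret D: left_brace D_brace by (rule left_brace_D_brace)
  \<comment> \<open>The image is a subgroup for both operations and contains \<open>a\<close> as the
    value at \<open>(1, 0, 0)\<close>, so it contains the subbrace generated by \<open>a\<close>,
    which is all of \<open>A\<close>.\<close>
  have "subbrace (range f) A"
    unfolding subbrace_def
    using group_hom.img_is_subgroup[OF group_hom.intro[OF D.add.is_group add.is_group
          group_hom_axioms.intro[OF add]]]
      group_hom.img_is_subgroup[OF group_hom.intro[OF D.is_group is_group
          group_hom_axioms.intro[OF mult]]]
    by simp
  moreover have "a \<in> range f"
    using a(1) bc_carrier[OF ctxt]
    by (intro range_eqI[of _ _ "(1, 0, 0)"]) (simp add: f_def D_map_def[OF ctxt])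
  ultimately have "carrier A \<subseteq> range f"
    using a(2) by (auto simp: generated_subbrace_def)
  then have "f \<in> brace_epi D_brace A"
    using add mult carrier by (auto simp: brace_epi_def)
  then show ?thesis by blast
qed

theorem theoremB2:
  "one_generator_left_brace D_brace \<and>
   (\<forall>A :: ('a, 'm) ring_scheme.
      one_generator_left_brace A \<and> A \<in> NS 4 3 \<longrightarrow> (\<exists>f. f \<in> brace_epi D_brace A))"
proof (intro conjI allI impI one_generator_D_brace)
  fix A :: "('a, 'm) ring_scheme"
  assume "one_generator_left_brace A \<and> A \<in> NS 4 3"
  then obtain a where "left_brace A" "a \<in> carrier A" "generated_subbrace A a = carrier A"
    and "left_series A 3 = {\<zero>\<^bsub>A\<^esub>}" "right_series A 4 = {\<zero>\<^bsub>A\<^esub>}"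
    unfolding one_generator_left_brace_def NS_def by blast
  then show "\<exists>f. f \<in> brace_epi D_brace A"
    by (rule left_brace.ex_brace_epi_D_brace)
qed

end
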